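(* Let $\mathcal{H}$ be a complex Hilbert space, $P,Q,R,S\in\mathcal{L}(\mathcal{H})$ and $q\in(0,1]$. Then $$w_q\left(\begin{bmatrix}P&Q\\R&S\end{bmatrix}\right)\le\frac{q+2\sqrt{1-q^2}}{2q}\Big\{\max\big\{w_q((R-Q)+i(P+S)),\,w_q((R-Q)-i(P+S))\big\}+\big(w_q(Q+R)+w_q(S-P)\big)\Big\}.$$
   Context: $\mathcal{L}(\mathcal{H})$ is the algebra of bounded linear operators on the complex Hilbert space $\mathcal{H}$. For $q\in\mathbb{C}$ with $|q|\le 1$, the $q$-numerical radius of a bounded operator $T$ on a Hilbert space $\mathcal{K}$ is $w_q(T)=\sup\{|\langle Tx,y\rangle| : x,y\in\mathcal{K},\ \|x\|=\|y\|=1,\ \langle x,y\rangle=q\}$. A $2\times2$ operator matrix with entries in $\mathcal{L}(\mathcal{H})$ acts on the Hilbert space direct sum $\mathcal{H}\oplus\mathcal{H}$.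
   Formalization: For q<1 the Hilbert space H is assumed not to have complex dimension 1: there no unit x, y satisfy ⟨x,y⟩=q, so w_q on H is a supremum over the empty set, and with value 0 the inequality fails for P=S=I, Q=R=0. *)

theory Defs
  imports "HOL-Analysis.Analysis"
begin

class complex_vector = real_vector +
  fixes scaleC :: "complex \<Rightarrow> 'a \<Rightarrow> 'a"  (infixr "*\<^sub>C" 75)
  assumes scaleC_add_right: "c *\<^sub>C (x + y) = c *\<^sub>C x + c *\<^sub>C y"
    and scaleC_add_left: "(c + d) *\<^sub>C x = c *\<^sub>C x + d *\<^sub>C x"
    and scaleC_scaleC: "c *\<^sub>C d *\<^sub>C x = (c * d) *\<^sub>C x"
    and scaleC_of_real: "complex_of_real r *\<^sub>C x = r *\<^sub>R x"

lemma scaleC_one: "1 *\<^sub>C x = (x :: 'a::complex_vector)"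
  using scaleC_of_real[of 1 x] by simp

text \<open>Beware that \<open>complex_vector.dim\<close>, the complex dimension, is 0 for an infinite-dimensional
  space. If the dimension is 1 and \<open>\<bar>q\<bar> < 1\<close>, no unit vectors have inner product \<open>q\<close>, so that
  the \<open>q\<close>-numerical radius below is a supremum over the empty set.\<close>

global_interpretation complex_vector:
  vector_space "scaleC :: complex \<Rightarrow> 'a \<Rightarrow> 'a::complex_vector"
  by unfold_locales (simp_all add: scaleC_add_right scaleC_add_left scaleC_scaleC scaleC_one)

text \<open>The inner product is linear in the first argument. The last axiom says both that it is
  positive definite and that the ambient norm is the one it induces.\<close>

class complex_inner = complex_vector + real_normed_vector +
  fixes cinner :: "'a \<Rightarrow> 'a \<Rightarrow> complex"
  assumes cinner_commute: "cinner x y = cnj (cinner y x)"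
    and cinner_add_left: "cinner (x + y) z = cinner x z + cinner y z"
    and cinner_scaleC_left: "cinner (c *\<^sub>C x) y = c * cinner x y"
    and cinner_self: "cinner x x = complex_of_real ((norm x)\<^sup>2)"

class complex_hilbert_space = complex_inner + banach

instantiation complex :: complex_hilbert_space
begin

definition scaleC_complex :: "complex \<Rightarrow> complex \<Rightarrow> complex"
  where "scaleC_complex c x = c * x"

definition cinner_complex :: "complex \<Rightarrow> complex \<Rightarrow> complex"
  where "cinner_complex x y = x * cnj y"

instance
proof
  fix x y z c d :: complex and r :: real
  show "c *\<^sub>C (x + y) = c *\<^sub>C x + c *\<^sub>C y"
    unfolding scaleC_complex_def by (rule distrib_left)
  show "(c + d) *\<^sub>C x = c *\<^sub>C x + d *\<^sub>C x"
    unfolding scaleC_complex_def by (rule distrib_right)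
  show "c *\<^sub>C d *\<^sub>C x = (c * d) *\<^sub>C x"
    unfolding scaleC_complex_def by (rule mult.assoc [symmetric])
  show "complex_of_real r *\<^sub>C x = r *\<^sub>R x"
    unfolding scaleC_complex_def by (rule scaleR_conv_of_real [symmetric])
  show "cinner x y = cnj (cinner y x)"
    unfolding cinner_complex_def by (simp add: mult.commute)
  show "cinner (x + y) z = cinner x z + cinner y z"
    unfolding cinner_complex_def by (rule distrib_right)
  show "cinner (c *\<^sub>C x) y = c * cinner x y"
    unfolding cinner_complex_def scaleC_complex_def by (rule mult.assoc)
  show "cinner x x = complex_of_real ((norm x)\<^sup>2)"
    unfolding cinner_complex_def by (rule complex_norm_square [symmetric])
qed

end

text \<open>The Hilbert space direct sum. The library norm on pairs is already the Euclidean one,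
  \<open>sqrt ((norm x)\<^sup>2 + (norm y)\<^sup>2)\<close>.\<close>

instantiation prod :: (complex_vector, complex_vector) complex_vector
begin

definition scaleC_prod :: "complex \<Rightarrow> 'a \<times> 'b \<Rightarrow> 'a \<times> 'b"
  where "scaleC_prod c x = (c *\<^sub>C fst x, c *\<^sub>C snd x)"

instance
  by standard (auto simp: scaleC_prod_def scaleC_add_right scaleC_add_left scaleC_scaleC
      scaleC_of_real prod_eq_iff)

end

instantiation prod :: (complex_inner, complex_inner) complex_inner
begin

definition cinner_prod :: "'a \<times> 'b \<Rightarrow> 'a \<times> 'b \<Rightarrow> complex"
  where "cinner_prod x y = cinner (fst x) (fst y) + cinner (snd x) (snd y)"

instance
proof
  fix x y z :: "'a \<times> 'b" and c :: complex
  show "cinner x y = cnj (cinner y x)"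
    unfolding cinner_prod_def by (simp flip: cinner_commute)
  show "cinner (x + y) z = cinner x z + cinner y z"
    by (simp add: cinner_prod_def cinner_add_left)
  show "cinner (c *\<^sub>C x) y = c * cinner x y"
    by (simp add: cinner_prod_def scaleC_prod_def cinner_scaleC_left algebra_simps)
  show "cinner x x = complex_of_real ((norm x)\<^sup>2)"
    by (simp add: cinner_prod_def cinner_self norm_prod_def)
qed

end

instance prod :: (complex_hilbert_space, complex_hilbert_space) complex_hilbert_space ..

definition bounded_clinear :: "('a::complex_inner \<Rightarrow> 'b::complex_inner) \<Rightarrow> bool"
  where "bounded_clinear T \<longleftrightarrow> bounded_linear T \<and> (\<forall>c x. T (c *\<^sub>C x) = c *\<^sub>C T x)"

text \<open>The supremum is taken in \<open>[0, \<infinity>)\<close>: the element 0 only matters if there is no admissible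
  pair \<open>(x, y)\<close>, where the library leaves the real supremum unspecified.\<close>

definition q_numerical_radius :: "complex \<Rightarrow> ('a::complex_inner \<Rightarrow> 'a) \<Rightarrow> real"
  where "q_numerical_radius q T =
    Sup (insert 0 {cmod (cinner (T x) y) | x y. norm x = 1 \<and> norm y = 1 \<and> cinner x y = q})"

definition operator_matrix ::
  "('a::complex_inner \<Rightarrow> 'a) \<Rightarrow> ('a \<Rightarrow> 'a) \<Rightarrow> ('a \<Rightarrow> 'a) \<Rightarrow> ('a \<Rightarrow> 'a) \<Rightarrow> 'a \<times> 'a \<Rightarrow> 'a \<times> 'a"
  where "operator_matrix P Q R S = (\<lambda>(x, y). (P x + Q y, R x + S y))"

end

theory Submission
  imports Defs
begin

text \<open>Let \<open>w\<close> be the usual numerical radius. A unit vector \<open>y\<close> with \<open>\<langle>x, y\<rangle> = q\<close> is \<open>q x + z\<close> with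
  \<open>z\<close> orthogonal to \<open>x\<close> and of norm \<open>sqrt (1 - q\<^sup>2)\<close>, and polarization gives
  \<open>\<bar>\<langle>T x, z\<rangle>\<bar> \<le> 2 w(T) \<parallel>x\<parallel> \<parallel>z\<parallel>\<close>; hence \<open>w\<^sub>q(T) \<le> (q + 2 sqrt (1 - q\<^sup>2)) w(T)\<close>. Conversely,
  averaging over \<open>y = q x \<plusminus> z\<close> gives \<open>q w(T) \<le> w\<^sub>q(T)\<close>. It remains to bound the usual numerical
  radius of the operator matrix, whose quadratic form at \<open>(x, y)\<close> is a combination of those of
  \<open>(R - Q) \<plusminus> i (P + S)\<close> at \<open>x \<mp> i y\<close>, of \<open>Q + R\<close> at \<open>x \<plusminus> y\<close>, and of \<open>S - P\<close> at \<open>x\<close> and \<open>y\<close>.\<close>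

section \<open>Complex inner product spaces\<close>

lemma cinner_add_right: "cinner x (y + z) = cinner x y + cinner x z"
  by (metis cinner_add_left cinner_commute complex_cnj_add)

lemma cinner_scaleC_right: "cinner x (c *\<^sub>C y) = cnj c * cinner x y"
  by (metis cinner_commute cinner_scaleC_left complex_cnj_mult)

lemma cinner_minus_left: "cinner (- x) y = - cinner x y"
  by (metis cinner_scaleC_left complex_vector.scale_minus_left mult_minus1 scaleC_one)

lemma cinner_minus_right: "cinner x (- y) = - cinner x y"
  by (metis cinner_commute cinner_minus_left complex_cnj_minus)

lemma cinner_diff_left: "cinner (x - y) z = cinner x z - cinner y z"
  using cinner_add_left[of x "- y" z] by (simp add: cinner_minus_left)

lemma cinner_diff_right: "cinner x (y - z) = cinner x y - cinner x z"
  using cinner_add_right[of x y "- z"] by (simp add: cinner_minus_right)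

lemma cinner_zero_right [simp]: "cinner x 0 = 0"
  using cinner_diff_right[of x 0 0] by simp

text \<open>The ambient norm is only known to be homogeneous for real scalars. For complex ones the
  claim comes from \<open>cinner_self\<close>, by comparing squares embedded in the complex
  numbers.\<close>

lemma norm_scaleC: "norm (c *\<^sub>C x) = cmod c * norm (x :: 'a::complex_inner)"
proof -
  have "complex_of_real ((norm (c *\<^sub>C x))\<^sup>2) = c * cnj c * complex_of_real ((norm x)\<^sup>2)"
    by (simp only: cinner_scaleC_left cinner_scaleC_right mult_ac flip: cinner_self)
  also have "\<dots> = complex_of_real ((cmod c * norm x)\<^sup>2)"
    by (simp only: of_real_mult power_mult_distrib complex_norm_square)
  finally show ?thesis
    by (simp only: of_real_eq_iff) simp
qed

lemma norm_normalize:
  fixes x :: "'a::complex_inner"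
  shows "x \<noteq> 0 \<Longrightarrow> norm (complex_of_real (inverse (norm x)) *\<^sub>C x) = 1"
  by (simp add: norm_scaleC norm_inverse del: of_real_inverse)

lemma parallelogram_law:
  "(norm (x + y))\<^sup>2 + (norm (x - y))\<^sup>2 = 2 * ((norm (x :: 'a::complex_inner))\<^sup>2 + (norm y)\<^sup>2)"
proof -
  have "complex_of_real ((norm (x + y))\<^sup>2 + (norm (x - y))\<^sup>2)
      = complex_of_real (2 * ((norm x)\<^sup>2 + (norm y)\<^sup>2))"
    by (simp only: of_real_add of_real_mult of_real_numeral flip: cinner_self)
      (simp add: cinner_add_left cinner_add_right cinner_diff_left cinner_diff_right)
  then show ?thesis
    by (simp only: of_real_eq_iff)
qed

lemma pythagoras:
  assumes "cinner x y = 0"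
  shows "(norm (x + y))\<^sup>2 = (norm (x :: 'a::complex_inner))\<^sup>2 + (norm y)\<^sup>2"
proof -
  have "cinner y x = 0"
    using assms by (metis cinner_commute complex_cnj_zero)
  with assms have "complex_of_real ((norm (x + y))\<^sup>2) = complex_of_real ((norm x)\<^sup>2 + (norm y)\<^sup>2)"
    by (simp only: of_real_add flip: cinner_self) (simp add: cinner_add_left cinner_add_right)
  then show ?thesis
    by (simp only: of_real_eq_iff)
qed

lemma cinner_unit_diff_right:
  fixes x y :: "'a::complex_inner"
  assumes "norm x = 1"
  shows "cinner x (y - cnj (cinner x y) *\<^sub>C x) = 0"
  using assms by (simp add: cinner_diff_right cinner_scaleC_right cinner_self)

text \<open>Pythagoras for the projection of \<open>y\<close> onto the line through
  \<open>x\<close>. Dropping the last term yields Cauchy-Schwarz; keeping it gives the norm of the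
  component orthogonal to \<open>x\<close>.\<close>

lemma norm_sq_unit_decomposition:
  fixes x y :: "'a::complex_inner"
  assumes "norm x = 1"
  shows "(norm y)\<^sup>2 = (cmod (cinner x y))\<^sup>2 + (norm (y - cnj (cinner x y) *\<^sub>C x))\<^sup>2"
  using pythagoras[of "cnj (cinner x y) *\<^sub>C x" "y - cnj (cinner x y) *\<^sub>C x"]
    cinner_unit_diff_right[OF assms, of y] assms
  by (simp add: cinner_scaleC_left norm_scaleC)

lemma cmod_cinner_le:
  fixes x y :: "'a::complex_inner"
  shows "cmod (cinner x y) \<le> norm x * norm y"
proof (cases "x = 0")
  case True
  then show ?thesis
    \<comment> \<open>Since \<open>- 0 = 0\<close>, this instance says that
      \<open>cinner 0 y\<close> is its own negative.\<close>
    using cinner_minus_left[of 0 y] by simp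
next
  case False
  define u where "u = complex_of_real (inverse (norm x)) *\<^sub>C x"
  have "norm u = 1"
    unfolding u_def by (rule norm_normalize[OF False])
  then have "(cmod (cinner u y))\<^sup>2 \<le> (norm y)\<^sup>2"
    using norm_sq_unit_decomposition[of u y] by simp
  then have "cmod (cinner u y) \<le> norm y"
    by (rule power2_le_imp_le) simp
  then show ?thesis
    using False by (simp add: u_def cinner_scaleC_left norm_divide field_simps)
qed

text \<open>Unless \<open>{x}\<close> is a basis, some vector lies outside its span, and its
  orthogonal component can be normalized. The form \<open>\<noteq> 1\<close> admits
  infinite-dimensional spaces, where \<open>dim\<close> is 0; the unit vector \<open>x\<close> rules
  out the zero space.\<close>

lemma exists_orthogonal_unit_vector:
  fixes x :: "'a::complex_inner"
  assumes "complex_vector.dim (UNIV :: 'a set) \<noteq> 1" and x: "norm x = 1"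
  obtains z where "norm z = 1" and "cinner x z = 0"
proof -
  have "\<exists>v. v \<notin> complex_vector.span {x}"
  proof (rule ccontr)
    assume "\<not> ?thesis"
    then have "complex_vector.span {x} = complex_vector.span UNIV"
      by auto
    moreover have "complex_vector.independent {x}"
      using x complex_vector.dependent_single by force
    ultimately show False
      using assms(1) complex_vector.dim_eq_card[of "{x}" UNIV] by simp
  qed
  then obtain v where v: "v \<notin> complex_vector.span {x}" ..
  define w where "w = v - cnj (cinner x v) *\<^sub>C x"
  have "w \<noteq> 0"
    using v by (auto simp: w_def complex_vector.span_singleton)
  moreover have "cinner x w = 0"
    unfolding w_def by (rule cinner_unit_diff_right[OF x])
  ultimately show ?thesis
    by (intro that[of "complex_of_real (inverse (norm w)) *\<^sub>C w"])
      (simp_all add: norm_normalize cinner_scaleC_right del: of_real_inverse)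
qed

text \<open>This removes a term \<open>b\<close> of unknown size when bounds are available for both
  of its signs.\<close>

lemma norm_two_mult_le:
  fixes a b :: complex
  shows "cmod (2 * a) \<le> cmod (a + b) + cmod (a - b)"
proof -
  have "2 * a = (a + b) + (a - b)"
    by simp
  then show ?thesis
    using norm_triangle_ineq[of "a + b" "a - b"] by (simp only:)
qed

section \<open>Bounded complex linear operators\<close>

lemma bounded_clinear_scaleC:
  assumes "bounded_clinear T"
  shows "bounded_clinear (\<lambda>x. c *\<^sub>C T x)"
proof -
  have "bounded_linear (\<lambda>x::'b. c *\<^sub>C x)" for c
  proof
    show "\<exists>K. \<forall>x::'b. norm (c *\<^sub>C x) \<le> norm x * K"
      by (auto intro!: exI[of _ "cmod c"] simp: norm_scaleC)
  qed (simp_all add: scaleC_add_right scaleC_scaleC mult.commute flip: scaleC_of_real)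
  with assms show ?thesis
    unfolding bounded_clinear_def
    by (auto intro: bounded_linear_compose simp: scaleC_scaleC mult.commute)
qed

lemma bounded_clinear_add:
  "bounded_clinear S \<Longrightarrow> bounded_clinear T \<Longrightarrow> bounded_clinear (\<lambda>x. S x + T x)"
  unfolding bounded_clinear_def by (auto intro: bounded_linear_add simp: scaleC_add_right)

lemma bounded_clinear_diff:
  "bounded_clinear S \<Longrightarrow> bounded_clinear T \<Longrightarrow> bounded_clinear (\<lambda>x. S x - T x)"
  unfolding bounded_clinear_def
  by (auto intro: bounded_linear_sub simp: complex_vector.scale_right_diff_distrib)

lemma bounded_clinear_operator_matrix:
  assumes "bounded_clinear P" and "bounded_clinear Q" and "bounded_clinear R" and "bounded_clinear S"
  shows "bounded_clinear (operator_matrix P Q R S)"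
proof -
  have eq: "operator_matrix P Q R S = (\<lambda>z. (P (fst z) + Q (snd z), R (fst z) + S (snd z)))"
    by (auto simp: operator_matrix_def)
  have "bounded_linear (operator_matrix P Q R S)"
    unfolding eq using assms unfolding bounded_clinear_def
    by (intro bounded_linear_Pair bounded_linear_add)
      (auto intro: bounded_linear_compose bounded_linear_fst bounded_linear_snd)
  then show ?thesis
    using assms unfolding bounded_clinear_def eq
    by (simp add: scaleC_prod_def scaleC_add_right)
qed

lemma bounded_clinear_simps:
  assumes "bounded_clinear T"
  shows "T (x + y) = T x + T y" and "T (x - y) = T x - T y" and "T (c *\<^sub>C x) = c *\<^sub>C T x"
  using assms unfolding bounded_clinear_def
  by (auto simp: linear_simps)

text \<open>Reversing the sign of \<open>y\<close> changes only the cross terms, so subtracting the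
  two forms isolates them. The scalar \<open>c\<close> will be 1 or \<open>\<i>\<close>.\<close>

lemma quadratic_form_add:
  assumes "bounded_clinear T"
  shows "cinner (T (x + c *\<^sub>C y)) (x + c *\<^sub>C y) = cinner (T x) x + c * cnj c * cinner (T y) y
    + (c * cinner (T y) x + cnj c * cinner (T x) y)"
  by (simp add: bounded_clinear_simps[OF assms] cinner_add_left cinner_add_right
      cinner_scaleC_left cinner_scaleC_right algebra_simps)

lemma quadratic_form_diff:
  assumes "bounded_clinear T"
  shows "cinner (T (x - c *\<^sub>C y)) (x - c *\<^sub>C y) = cinner (T x) x + c * cnj c * cinner (T y) y
    - (c * cinner (T y) x + cnj c * cinner (T x) y)"
  by (simp add: bounded_clinear_simps[OF assms] cinner_diff_left cinner_diff_right
      cinner_scaleC_left cinner_scaleC_right algebra_simps)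

section \<open>Numerical radius and \<open>q\<close>-numerical radius\<close>

text \<open>Quantifying over all vectors instead of the unit vectors avoids a supremum, and with it a
  special treatment of the zero space.\<close>

definition numerical_radius_le :: "('a::complex_inner \<Rightarrow> 'a) \<Rightarrow> real \<Rightarrow> bool"
  where "numerical_radius_le T m \<longleftrightarrow> (\<forall>x. cmod (cinner (T x) x) \<le> m * (norm x)\<^sup>2)"

lemma numerical_radius_leD:
  "numerical_radius_le T m \<Longrightarrow> cmod (cinner (T x) x) \<le> m * (norm x)\<^sup>2"
  by (simp add: numerical_radius_le_def)

lemma numerical_radius_le_polarization:
  assumes "bounded_clinear T" and m: "numerical_radius_le T m" and "cmod c = 1"
  shows "cmod (c * cinner (T y) x + cnj c * cinner (T x) y) \<le> m * ((norm x)\<^sup>2 + (norm y)\<^sup>2)"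
proof -
  let ?q = "\<lambda>v. cinner (T v) v"
  have "2 * cmod (c * cinner (T y) x + cnj c * cinner (T x) y)
      = cmod (?q (x + c *\<^sub>C y) - ?q (x - c *\<^sub>C y))"
  proof -
    have "?q (x + c *\<^sub>C y) - ?q (x - c *\<^sub>C y) = 2 * (c * cinner (T y) x + cnj c * cinner (T x) y)"
      unfolding quadratic_form_add[OF assms(1)] quadratic_form_diff[OF assms(1)] by simp
    then show ?thesis
      by (simp only: norm_mult norm_numeral)
  qed
  also have "\<dots> \<le> m * (norm (x + c *\<^sub>C y))\<^sup>2 + m * (norm (x - c *\<^sub>C y))\<^sup>2"
    by (intro order.trans[OF norm_triangle_ineq4] add_mono numerical_radius_leD[OF m])
  also have "\<dots> = m * (2 * ((norm x)\<^sup>2 + (norm y)\<^sup>2))"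
    unfolding distrib_left[symmetric] parallelogram_law by (simp add: norm_scaleC \<open>cmod c = 1\<close>)
  finally show ?thesis
    by (simp add: algebra_simps)
qed

text \<open>Polarization with \<open>c = 1\<close> and \<open>c = \<i>\<close> bounds both the sum
  and the difference of \<open>cinner (T z) x\<close> and \<open>cinner (T x) z\<close> by
  \<open>2 * m\<close>; together these bound twice the second one by \<open>4 * m\<close>.\<close>

lemma numerical_radius_le_cinner_unit:
  assumes "bounded_clinear T" and "numerical_radius_le T m" and "norm x = 1" and "norm z = 1"
  shows "cmod (cinner (T x) z) \<le> 2 * m"
proof -
  let ?a = "cinner (T z) x" and ?b = "cinner (T x) z"
  have "cmod (?a + ?b) \<le> 2 * m" "cmod (\<i> * ?a - \<i> * ?b) \<le> 2 * m"
    using numerical_radius_le_polarization[OF assms(1,2), of 1 z x]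
      numerical_radius_le_polarization[OF assms(1,2), of \<i> z x] assms(3,4) by simp_all
  moreover have "cmod (\<i> * ?a - \<i> * ?b) = cmod (?a - ?b)"
    by (simp add: norm_mult flip: right_diff_distrib)
  moreover have "cmod (2 * ?b) \<le> cmod (?a + ?b) + cmod (?a - ?b)"
    using norm_two_mult_le[of ?b ?a] by (simp add: add.commute norm_minus_commute)
  ultimately show ?thesis
    by (simp add: norm_mult)
qed

lemma numerical_radius_le_cinner:
  assumes "bounded_clinear T" and "numerical_radius_le T m" and "norm x = 1"
  shows "cmod (cinner (T x) z) \<le> 2 * m * norm z"
proof (cases "z = 0")
  case False
  define u where "u = complex_of_real (inverse (norm z)) *\<^sub>C z"
  have "norm u = 1"
    unfolding u_def by (rule norm_normalize[OF False])
  then have "cmod (cinner (T x) u) \<le> 2 * m"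
    using assms by (intro numerical_radius_le_cinner_unit)
  then show ?thesis
    using False by (simp add: u_def cinner_scaleC_right norm_mult norm_divide field_simps)
qed simp

section \<open>Comparison of the \<open>q\<close>-numerical radius with the numerical radius\<close>

lemma q_numerical_radius_bdd_above:
  assumes "bounded_clinear T"
  shows "bdd_above (insert 0 {cmod (cinner (T x) y) | x y. norm x = 1 \<and> norm y = 1 \<and> cinner x y = q})"
proof -
  obtain K where "\<And>x. norm (T x) \<le> norm x * K"
    using assms bounded_linear.bounded unfolding bounded_clinear_def by blast
  then have "cmod (cinner (T x) y) \<le> K" if "norm x = 1" "norm y = 1" for x y
    using cmod_cinner_le[of "T x" y] that by (metis mult.commute mult_1 order.trans)
  then show ?thesis
    \<comment> \<open>On the zero space \<open>K\<close> may be negative, while the set always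
      contains 0.\<close>
    by (intro bdd_aboveI[of _ "max 0 K"]) (auto simp: le_max_iff_disj)
qed

lemma q_numerical_radius_nonneg: "bounded_clinear T \<Longrightarrow> 0 \<le> q_numerical_radius q T"
  unfolding q_numerical_radius_def by (rule cSup_upper[OF _ q_numerical_radius_bdd_above]) auto

lemma cmod_cinner_le_q_numerical_radius:
  assumes "bounded_clinear T" and "norm x = 1" and "norm y = 1" and "cinner x y = q"
  shows "cmod (cinner (T x) y) \<le> q_numerical_radius q T"
  unfolding q_numerical_radius_def
  by (rule cSup_upper[OF _ q_numerical_radius_bdd_above[OF assms(1)]]) (use assms in auto)

lemma q_numerical_radius_le:
  fixes q :: real
  assumes "bounded_clinear T" and m: "numerical_radius_le T m" and "0 \<le> m" and "0 \<le> q" and "q \<le> 1"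
  shows "q_numerical_radius q T \<le> (q + 2 * sqrt (1 - q\<^sup>2)) * m"
proof -
  have "q\<^sup>2 \<le> 1"
    using assms by (simp add: power_le_one)
  have "cmod (cinner (T x) y) \<le> (q + 2 * sqrt (1 - q\<^sup>2)) * m"
    if "norm x = 1" "norm y = 1" "cinner x y = q" for x y
  proof -
    \<comment> \<open>As \<open>q\<close> is real, it equals \<open>cnj (cinner x y)\<close>, so
      \<open>z\<close> is the component of \<open>y\<close> orthogonal to \<open>x\<close>.\<close>
    define z where "z = y - complex_of_real q *\<^sub>C x"
    have "norm z = sqrt (1 - q\<^sup>2)"
      using norm_sq_unit_decomposition[of x y] that \<open>0 \<le> q\<close>
      by (intro real_sqrt_unique[symmetric]) (simp_all add: z_def)
    then have "cmod (cinner (T x) z) \<le> 2 * m * sqrt (1 - q\<^sup>2)"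
      using numerical_radius_le_cinner[OF assms(1,2) that(1), of z] by simp
    moreover have "cmod (q * cinner (T x) x) \<le> q * m"
      using numerical_radius_leD[OF m, of x] that \<open>0 \<le> q\<close>
      by (simp add: norm_mult mult_left_mono)
    moreover have "cinner (T x) y = q * cinner (T x) x + cinner (T x) z"
      by (simp add: z_def cinner_diff_right cinner_scaleC_right)
    ultimately show ?thesis
      using norm_triangle_ineq[of "q * cinner (T x) x" "cinner (T x) z"]
      by (simp add: algebra_simps)
  qed
  \<comment> \<open>The bound must also dominate the element 0 inserted into the set.\<close>
  moreover have "0 \<le> (q + 2 * sqrt (1 - q\<^sup>2)) * m"
    using assms \<open>q\<^sup>2 \<le> 1\<close> by simp
  ultimately show ?thesis
    unfolding q_numerical_radius_def by (intro cSup_least) auto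
qed

lemma numerical_radius_le_q_numerical_radius:
  fixes T :: "'a::complex_inner \<Rightarrow> 'a" and q :: real
  assumes T: "bounded_clinear T" and "0 < q" and "q \<le> 1"
    and dim: "q < 1 \<Longrightarrow> complex_vector.dim (UNIV :: 'a set) \<noteq> 1"
  shows "numerical_radius_le T (q_numerical_radius q T / q)"
proof -
  let ?w = "q_numerical_radius q T"
  have unit: "q * cmod (cinner (T x) x) \<le> ?w" if x: "norm x = 1" for x
  proof -
    define s where "s = sqrt (1 - q\<^sup>2)"
    have s: "s\<^sup>2 = 1 - q\<^sup>2"
      using assms(2,3) by (simp add: s_def power_le_one)
    \<comment> \<open>For \<open>q < 1\<close> an orthogonal direction must exist, which is where
      the dimension enters; for \<open>q = 1\<close> the length \<open>s\<close> is 0 and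
      \<open>z = 0\<close> serves.\<close>
    obtain z where z: "norm z = s" "cinner x z = 0"
    proof (cases "q < 1")
      case True
      from exists_orthogonal_unit_vector[OF dim[OF True] x]
      obtain z where "norm z = 1" "cinner x z = 0" .
      moreover have "0 \<le> s"
        using assms(2,3) by (simp add: s_def power_le_one)
      ultimately show ?thesis
        by (intro that[of "complex_of_real s *\<^sub>C z"])
          (simp_all add: norm_scaleC cinner_scaleC_right)
    next
      case False
      then show ?thesis
        using \<open>q \<le> 1\<close> by (intro that[of 0]) (simp_all add: s_def)
    qed
    let ?u = "complex_of_real q *\<^sub>C x"
    have "cmod (cinner (T x) (?u + v)) \<le> ?w" if v: "norm v = s" "cinner x v = 0" for v
    proof (rule cmod_cinner_le_q_numerical_radius[OF T x])
      have "(norm (?u + v))\<^sup>2 = 1"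
        using pythagoras[of ?u v] v x s by (simp add: cinner_scaleC_left norm_scaleC)
      then show "norm (?u + v) = 1"
        by (simp add: power2_eq_1_iff) (use norm_ge_zero[of "?u + v"] in linarith)
      show "cinner x (?u + v) = q"
        using v x by (simp add: cinner_add_right cinner_scaleC_right cinner_self)
    qed
    from this[of z] this[of "- z"]
    have "cmod (q * cinner (T x) x + cinner (T x) z) \<le> ?w"
      "cmod (q * cinner (T x) x - cinner (T x) z) \<le> ?w"
      using z by (simp_all add: cinner_add_right cinner_diff_right cinner_minus_right
          cinner_scaleC_right)
    moreover have "cmod (2 * (q * cinner (T x) x))
        \<le> cmod (q * cinner (T x) x + cinner (T x) z) + cmod (q * cinner (T x) x - cinner (T x) z)"
      by (rule norm_two_mult_le)
    ultimately show ?thesis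
      using \<open>0 < q\<close> by (simp add: norm_mult)
  qed
  show ?thesis
    unfolding numerical_radius_le_def
  proof
    fix x
    show "cmod (cinner (T x) x) \<le> ?w / q * (norm x)\<^sup>2"
    proof (cases "x = 0")
      case False
      define u where "u = complex_of_real (inverse (norm x)) *\<^sub>C x"
      have "norm u = 1"
        unfolding u_def by (rule norm_normalize[OF False])
      then have "q * cmod (cinner (T u) u) \<le> ?w"
        by (rule unit)
      then show ?thesis
        using False \<open>0 < q\<close>
        by (simp add: u_def bounded_clinear_simps[OF T] cinner_scaleC_left cinner_scaleC_right
            norm_mult norm_divide field_simps power2_eq_square)
    qed simp
  qed
qed

text \<open>Twice the quadratic form of the matrix is the sum of
  \<open>\<langle>(P + S) x, x\<rangle> + \<langle>(P + S) y, y\<rangle> + \<langle>(R - Q) x, y\<rangle> - \<langle>(R - Q) y, x\<rangle>\<close>,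
  \<open>\<langle>(Q + R) y, x\<rangle> + \<langle>(Q + R) x, y\<rangle>\<close> and \<open>\<langle>(S - P) y, y\<rangle> - \<langle>(S - P) x, x\<rangle>\<close>.\<close>

lemma numerical_radius_le_operator_matrix:
  fixes P Q R S :: "'a::complex_inner \<Rightarrow> 'a"
  assumes PQRS: "bounded_clinear P" "bounded_clinear Q" "bounded_clinear R" "bounded_clinear S"
    and A: "numerical_radius_le (\<lambda>x. (R x - Q x) + \<i> *\<^sub>C (P x + S x)) m"
    and B: "numerical_radius_le (\<lambda>x. (R x - Q x) - \<i> *\<^sub>C (P x + S x)) m"
    and F: "numerical_radius_le (\<lambda>x. Q x + R x) k"
    and G: "numerical_radius_le (\<lambda>x. S x - P x) l"
  shows "numerical_radius_le (operator_matrix P Q R S) ((m + k + l) / 2)"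
  unfolding numerical_radius_le_def
proof
  fix z :: "'a \<times> 'a"
  obtain x y where z: "z = (x, y)"
    by (cases z)
  define N where "N = (norm x)\<^sup>2 + (norm y)\<^sup>2"
  have N: "(norm z)\<^sup>2 = N"
    by (simp add: N_def z norm_prod_def)
  let ?A = "\<lambda>x. (R x - Q x) + \<i> *\<^sub>C (P x + S x)"
  let ?B = "\<lambda>x. (R x - Q x) - \<i> *\<^sub>C (P x + S x)"
  let ?u = "x + \<i> *\<^sub>C y" and ?v = "x - \<i> *\<^sub>C y"
  \<comment> \<open>This is twice the first of the three sums: the diagonal terms involve
    \<open>?B - ?A\<close>, which is \<open>- 2 * \<i>\<close> times \<open>P + S\<close>, and the
    cross terms involve \<open>?A + ?B\<close>, which is twice \<open>R - Q\<close>.\<close>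
  define a where "a = \<i> * (cinner (?B ?u) ?u - cinner (?A ?v) ?v)"
  define f where "f = cinner (Q y + R y) x + cinner (Q x + R x) y"
  define g where "g = cinner (S y - P y) y - cinner (S x - P x) x"
  note bcl = PQRS bounded_clinear_add bounded_clinear_diff bounded_clinear_scaleC
  have AB: "bounded_clinear ?A" "bounded_clinear ?B"
    by (intro bcl)+
  have "4 * cinner (operator_matrix P Q R S z) z = a + 2 * f + 2 * g"
    unfolding a_def f_def g_def quadratic_form_add[OF AB(2)] quadratic_form_diff[OF AB(1)]
    by (simp add: z operator_matrix_def cinner_prod_def cinner_add_left cinner_diff_left
        cinner_scaleC_left algebra_simps)
  then have "4 * cmod (cinner (operator_matrix P Q R S z) z) = cmod (a + 2 * f + 2 * g)"
    by (metis norm_mult norm_numeral)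
  also have "\<dots> \<le> cmod a + 2 * cmod f + 2 * cmod g"
    using norm_triangle_ineq[of "a + 2 * f" "2 * g"] norm_triangle_ineq[of a "2 * f"]
    by (simp add: norm_mult)
  also have "cmod a \<le> 2 * m * N"
  proof -
    have "cmod a \<le> cmod (cinner (?B ?u) ?u) + cmod (cinner (?A ?v) ?v)"
      unfolding a_def norm_mult by (simp add: norm_triangle_ineq4)
    also have "\<dots> \<le> m * (norm ?u)\<^sup>2 + m * (norm ?v)\<^sup>2"
      by (rule add_mono[OF numerical_radius_leD[OF B] numerical_radius_leD[OF A]])
    also have "\<dots> = 2 * m * N"
      \<comment> \<open>\<open>?u\<close> and \<open>?v\<close> are the sum and the difference of
        \<open>x\<close> and \<open>\<i> *\<^sub>C y\<close>.\<close>
      unfolding distrib_left[symmetric] parallelogram_law by (simp add: norm_scaleC N_def)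
    finally show ?thesis .
  qed
  also have "cmod f \<le> k * N"
    using numerical_radius_le_polarization[OF bounded_clinear_add[OF PQRS(2,3)] F, of 1 y x]
    by (simp add: f_def N_def)
  also have "cmod g \<le> l * N"
    using norm_triangle_ineq4[of "cinner (S y - P y) y" "cinner (S x - P x) x"]
      numerical_radius_leD[OF G, of x] numerical_radius_leD[OF G, of y]
    by (simp add: g_def N_def distrib_left)
  finally show "cmod (cinner (operator_matrix P Q R S z) z) \<le> (m + k + l) / 2 * (norm z)\<^sup>2"
    by (simp add: N field_simps)
qed

theorem theorem2p1:
  fixes P Q R S :: "'a::complex_hilbert_space \<Rightarrow> 'a" and q :: real
  assumes "bounded_clinear P" and "bounded_clinear Q"
    and "bounded_clinear R" and "bounded_clinear S"
    and "0 < q" and "q \<le> 1"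
    and "q < 1 \<Longrightarrow> complex_vector.dim (UNIV :: 'a set) \<noteq> 1"
  shows "q_numerical_radius q (operator_matrix P Q R S) \<le>
    (q + 2 * sqrt (1 - q\<^sup>2)) / (2 * q) *
    (max (q_numerical_radius q (\<lambda>x. (R x - Q x) + \<i> *\<^sub>C (P x + S x)))
         (q_numerical_radius q (\<lambda>x. (R x - Q x) - \<i> *\<^sub>C (P x + S x)))
     + (q_numerical_radius q (\<lambda>x. Q x + R x) + q_numerical_radius q (\<lambda>x. S x - P x)))"
proof -
  let ?A = "\<lambda>x. (R x - Q x) + \<i> *\<^sub>C (P x + S x)" and ?B = "\<lambda>x. (R x - Q x) - \<i> *\<^sub>C (P x + S x)"
  let ?F = "\<lambda>x. Q x + R x" and ?G = "\<lambda>x. S x - P x"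
  let ?M = "max (q_numerical_radius q ?A) (q_numerical_radius q ?B)"
  let ?W = "?M + (q_numerical_radius q ?F + q_numerical_radius q ?G)"
  note bcl = assms(1-4) bounded_clinear_add bounded_clinear_diff bounded_clinear_scaleC
  have A: "bounded_clinear ?A" and B: "bounded_clinear ?B"
    and F: "bounded_clinear ?F" and G: "bounded_clinear ?G"
    by (intro bcl)+
  note le = numerical_radius_le_q_numerical_radius[OF _ assms(5-7)]
  have mono: "numerical_radius_le T n" if "numerical_radius_le T m" "m \<le> n"
    for T :: "'a \<Rightarrow> 'a" and m n
    using that unfolding numerical_radius_le_def
    by (meson mult_right_mono order.trans zero_le_power2)
  \<comment> \<open>Each passage from \<open>w\<close> to \<open>w\<^sub>q\<close> for an operator
    on the original space costs a factor \<open>1 / q\<close>. \<open>mono\<close> replaces the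
    bounds for \<open>?A\<close> and \<open>?B\<close> by their common maximum.\<close>
  have "numerical_radius_le (operator_matrix P Q R S)
      ((?M / q + q_numerical_radius q ?F / q + q_numerical_radius q ?G / q) / 2)"
    using \<open>0 < q\<close>
    by (intro numerical_radius_le_operator_matrix assms(1-4) le[OF F] le[OF G]
        mono[OF le[OF A]] mono[OF le[OF B]] divide_right_mono) auto
  then have "numerical_radius_le (operator_matrix P Q R S) (?W / (2 * q))"
    by (simp add: add_divide_distrib add.assoc mult.commute)
  moreover have "0 \<le> ?W / (2 * q)"
    using \<open>0 < q\<close> q_numerical_radius_nonneg[OF A, of q] q_numerical_radius_nonneg[OF F, of q]
      q_numerical_radius_nonneg[OF G, of q] by simp
  ultimately have "q_numerical_radius q (operator_matrix P Q R S)
      \<le> (q + 2 * sqrt (1 - q\<^sup>2)) * (?W / (2 * q))"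
    using assms(5,6)
    by (intro q_numerical_radius_le bounded_clinear_operator_matrix assms(1-4)) auto
  then show ?thesis
    by simp
qed

end
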